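(* Let $n\ge1$, $s\in(0,1)$, let $u\in H^s(\mathbb R^n)\cap L^1(\mathbb R^n)$, and let $\mathbf v\in\mathbf H^s(\mathbb R^n)$ with $|\mathbf v|\in L^1(\mathbb R^n)$. Then the truncated fractional divergence and gradient converge in $L^2$ to the untruncated ones as $\delta\to\infty$: $$\|\operatorname{div}^s_\delta\mathbf v-\operatorname{div}^s\mathbf v\|_{L^2(\mathbb R^n)}\to0,\qquad\|\operatorname{grad}^s_\delta u-\operatorname{grad}^su\|_{L^2(\mathbb R^n)}\to0\qquad\text{as }\delta\to\infty.$$
   Context: Integrals are in the principal value sense. $\mathbf H^s(\mathbb R^n)$ denotes vector fields with all components in $H^s(\mathbb R^n)$. The operators are $$\operatorname{grad}^su(\mathbf x)=\int_{\mathbb R^n}[u(\mathbf x)-u(\mathbf y)]\frac{\mathbf x-\mathbf y}{|\mathbf x-\mathbf y|}\frac{d\mathbf y}{|\mathbf x-\mathbf y|^{n+s}},\qquad \operatorname{div}^s\mathbf v(\mathbf x)=\int_{\mathbb R^n}[\mathbf v(\mathbf x)-\mathbf v(\mathbf y)]\cdot\frac{\mathbf x-\mathbf y}{|\mathbf x-\mathbf y|}\frac{d\mathbf y}{|\mathbf x-\mathbf y|^{n+s}},$$ and $\operatorname{grad}^s_\delta u$, $\operatorname{div}^s_\delta\mathbf v$ are obtained by multiplying the integrands by the indicator $\mathbf 1(|\mathbf x-\mathbf y|\le\delta)$, $\delta>0$. *)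

theory Defs
  imports "HOL-Analysis.Analysis"
begin

text \<open>Throughout, \<open>\<real>\<^sup>n\<close> is \<open>real ^ 'n\<close> with \<open>n = CARD('n)\<close>, and elements of \<open>L\<^sup>2\<close>, \<open>L\<^sup>1\<close> and
  \<open>H\<^sup>s\<close> are represented by Lebesgue measurable functions.\<close>

definition L2_space :: "(real ^ 'n \<Rightarrow> 'b::euclidean_space) set" where
  "L2_space = {f. f \<in> borel_measurable lebesgue \<and> integrable lebesgue (\<lambda>x. (norm (f x))\<^sup>2)}"

text \<open>Only meaningful on \<^const>\<open>L2_space\<close>: the Bochner integral of a non-integrable function is \<open>0\<close>.\<close>

definition L2_norm :: "(real ^ 'n \<Rightarrow> 'b::euclidean_space) \<Rightarrow> real" where
  "L2_norm f = sqrt (integral\<^sup>L lebesgue (\<lambda>x. (norm (f x))\<^sup>2))"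

text \<open>The fractional Sobolev space \<open>H\<^sup>s = W\<^sup>s\<^sup>,\<^sup>2\<close> for \<open>0 < s < 1\<close>, in its Gagliardo form.\<close>

definition gagliardo :: "real \<Rightarrow> (real ^ 'n \<Rightarrow> real) \<Rightarrow> ennreal" where
  "gagliardo s u =
     (\<integral>\<^sup>+x. (\<integral>\<^sup>+y. ennreal ((u x - u y)\<^sup>2 / norm (x - y) powr (real CARD('n) + 2 * s))
        \<partial>lebesgue) \<partial>lebesgue)"

definition Hs_space :: "real \<Rightarrow> (real ^ 'n \<Rightarrow> real) set" where
  "Hs_space s = {u. u \<in> L2_space \<and> gagliardo s u < \<infinity>}"

definition Hs_vec_space :: "real \<Rightarrow> (real ^ 'n \<Rightarrow> real ^ 'n) set" where
  "Hs_vec_space s = {v. \<forall>i. (\<lambda>x. v x $ i) \<in> Hs_space s}"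

text \<open>Principal value at the singularity \<open>x\<close>. For \<open>u\<close>, \<open>v\<close> in \<open>L\<^sup>1\<close> the integrands used below are
  absolutely integrable on the complement of every ball around \<open>x\<close>, so no limit at infinity is
  involved. Where the limit does not exist, \<^const>\<open>Lim\<close> is an unspecified value.\<close>

definition pv_integral :: "real ^ 'n \<Rightarrow> (real ^ 'n \<Rightarrow> 'b::euclidean_space) \<Rightarrow> 'b" where
  "pv_integral x f = Lim (at_right 0) (\<lambda>\<epsilon>. LINT y:{y. \<epsilon> < norm (x - y)}|lebesgue. f y)"

text \<open>The integrands vanish at \<open>y = x\<close>, by the convention \<open>1 / 0 = 0\<close>.\<close>

definition grad_integrand :: "real \<Rightarrow> (real ^ 'n \<Rightarrow> real) \<Rightarrow> real ^ 'n \<Rightarrow> real ^ 'n \<Rightarrow> real ^ 'n" where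
  "grad_integrand s u x y =
     (1 / norm (x - y) powr (real CARD('n) + s)) *\<^sub>R
       ((u x - u y) *\<^sub>R ((x - y) /\<^sub>R norm (x - y)))"

definition div_integrand :: "real \<Rightarrow> (real ^ 'n \<Rightarrow> real ^ 'n) \<Rightarrow> real ^ 'n \<Rightarrow> real ^ 'n \<Rightarrow> real" where
  "div_integrand s v x y =
     ((v x - v y) \<bullet> ((x - y) /\<^sub>R norm (x - y))) / norm (x - y) powr (real CARD('n) + s)"

definition frac_grad :: "real \<Rightarrow> (real ^ 'n \<Rightarrow> real) \<Rightarrow> real ^ 'n \<Rightarrow> real ^ 'n" where
  "frac_grad s u x = pv_integral x (grad_integrand s u x)"

definition frac_div :: "real \<Rightarrow> (real ^ 'n \<Rightarrow> real ^ 'n) \<Rightarrow> real ^ 'n \<Rightarrow> real" where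
  "frac_div s v x = pv_integral x (div_integrand s v x)"

definition trunc_grad :: "real \<Rightarrow> real \<Rightarrow> (real ^ 'n \<Rightarrow> real) \<Rightarrow> real ^ 'n \<Rightarrow> real ^ 'n" where
  "trunc_grad s \<delta> u x =
     pv_integral x (\<lambda>y. indicator {y. norm (x - y) \<le> \<delta>} y *\<^sub>R grad_integrand s u x y)"

definition trunc_div :: "real \<Rightarrow> real \<Rightarrow> (real ^ 'n \<Rightarrow> real ^ 'n) \<Rightarrow> real ^ 'n \<Rightarrow> real" where
  "trunc_div s \<delta> v x =
     pv_integral x (\<lambda>y. indicator {y. norm (x - y) \<le> \<delta>} y *\<^sub>R div_integrand s v x y)"

end

theory Submission
  imports Defs
begin

text \<open>Removing the part \<open>|x - y| > \<delta>\<close> does not affect convergence of the principal value at \<open>x\<close>, so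
  the truncated and untruncated operators differ either by the tail integral over \<open>|x - y| > \<delta>\<close> or,
  where neither principal value exists, by \<open>0\<close>. The kernel \<open>|x - y|\<^sup>-\<^sup>n\<^sup>-\<^sup>s\<close> has mass at most
  \<open>A \<delta>\<^sup>-\<^sup>s\<close> on \<open>|x - y| > \<delta>\<close>. By Cauchy-Schwarz with respect to this kernel, \<open>|a - b|\<^sup>2 \<le> 2|a|\<^sup>2 + 2|b|\<^sup>2\<close>
  and Tonelli, the tail integral has \<open>L\<^sup>2\<close> norm at most \<open>2 A \<delta>\<^sup>-\<^sup>s\<close> times that of \<open>u\<close> (or \<open>v\<close>).\<close>

section \<open>Lebesgue measure as a factor of product measures, and the tail kernel\<close>

lemma sigma_finite_lebesgue: "sigma_finite_measure (lebesgue :: 'a::euclidean_space measure)"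
proof
  have "(\<Union>n. cball (0::'a) (real n)) = UNIV"
    by (auto simp: real_arch_simple)
  then show "\<exists>A. countable A \<and> A \<subseteq> sets (lebesgue :: 'a measure) \<and> \<Union> A = space lebesgue
      \<and> (\<forall>a\<in>A. emeasure lebesgue a \<noteq> \<infinity>)"
    by (intro exI[of _ "range (\<lambda>n. cball (0::'a) (real n))"]) (auto simp: emeasure_cball)
qed

text \<open>Sigma-finiteness provides measurability of integrals depending on a parameter, and for
  the pair below the exchange of iterated integrals, directly for the completed measure.\<close>

interpretation lebesgue: sigma_finite_measure "lebesgue :: 'a::euclidean_space measure"
  by (rule sigma_finite_lebesgue)

interpretation lebesgue_pair: pair_sigma_finite
  "lebesgue :: 'a::euclidean_space measure" "lebesgue :: 'b::euclidean_space measure"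
  by unfold_locales

lemma measurable_lebesgue_ident [measurable]:
  "(\<lambda>x. x) \<in> borel_measurable (lebesgue :: 'a::euclidean_space measure)"
  using id_borel_measurable_lebesgue by (simp add: id_def)

text \<open>Setting the kernel to zero near the diagonal makes it integrable in \<open>y\<close>.
  Keeping both points as arguments makes its symmetry available when the order of integration is
  exchanged.\<close>

definition tail_kernel :: "real \<Rightarrow> real \<Rightarrow> 'a::euclidean_space \<Rightarrow> 'a \<Rightarrow> real" where
  "tail_kernel s \<delta> x y =
     (if \<delta> < norm (x - y) then 1 / norm (x - y) powr (real DIM('a) + s) else 0)"

lemma tail_kernel_nonneg: "0 \<le> tail_kernel s \<delta> x y"
  by (simp add: tail_kernel_def)

lemma tail_kernel_commute: "tail_kernel s \<delta> x y = tail_kernel s \<delta> y x"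
  by (simp add: tail_kernel_def norm_minus_commute)

lemma borel_measurable_tail_kernel [measurable]:
  assumes [measurable]: "f \<in> borel_measurable M" "g \<in> borel_measurable M"
  shows "(\<lambda>z. tail_kernel s \<delta> (f z) (g z)) \<in> borel_measurable M"
  unfolding tail_kernel_def by measurable

text \<open>On each dyadic annulus \<open>2\<^sup>k \<delta> \<le> |x - y| \<le> 2\<^sup>k\<^sup>+\<^sup>1 \<delta>\<close> the kernel is bounded by its value at the inner
  radius, which yields a geometric series with ratio \<open>2\<^sup>-\<^sup>s\<close>.\<close>

lemma tail_kernel_integral_le:
  assumes "0 < s"
  obtains A where "0 \<le> A"
    "\<And>\<delta> x. 0 < \<delta> \<Longrightarrow>
      (\<integral>\<^sup>+y. ennreal (tail_kernel s \<delta> (x::'a::euclidean_space) y) \<partial>lebesgue) \<le> ennreal (A * \<delta> powr - s)"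
proof
  define n where "n = DIM('a)"
  define V where "V = unit_ball_vol (real n)"
  define q where "q = 2 powr - s"
  \<comment> \<open>Each annulus is measured by the whole ball of its outer radius, which costs the
    factor \<open>2 ^ n\<close>; the geometric series contributes
    \<open>1 / (1 - q)\<close>.\<close>
  define A where "A = V * 2 ^ n * (1 / (1 - q))"
  have q: "0 < q" "q < 1"
    using \<open>0 < s\<close> by (auto simp: q_def powr_less_one)
  have V: "0 \<le> V"
    by (simp add: V_def)
  show "0 \<le> A"
    using q V by (simp add: A_def)
  fix \<delta> :: real and x :: 'a assume \<delta>: "0 < \<delta>"
  define c where "c k = 1 / (2 ^ k * \<delta>) powr (real n + s)" for k :: nat
  have c_nonneg: "0 \<le> c k" for k
    by (simp add: c_def)
  \<comment> \<open>A single summand already dominates the kernel at \<open>y\<close>. Full balls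
    overlap, but only an upper bound is wanted, so no disjointness has to be tracked.\<close>
  have layer: "ennreal (tail_kernel s \<delta> x y)
      \<le> (\<Sum>k. ennreal (c k) * indicator (cball x (2 ^ Suc k * \<delta>)) y)" for y
  proof (cases "\<delta> < norm (x - y)")
    case True
    \<comment> \<open>Minimality of \<open>m\<close> makes the preceding dyadic radius a lower bound
      for the distance. A preceding radius exists because \<open>m = 0\<close> would put
      \<open>y\<close> within distance \<open>\<delta>\<close> of \<open>x\<close>.\<close>
    obtain m where m: "norm (x - y) \<le> 2 ^ m * \<delta>" "\<And>i. i < m \<Longrightarrow> \<not> norm (x - y) \<le> 2 ^ i * \<delta>"
    proof -
      obtain j where "norm (x - y) / \<delta> < 2 ^ j"
        using real_arch_pow[of 2] by auto
      then have "norm (x - y) \<le> 2 ^ j * \<delta>"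
        using \<delta> by (simp add: field_simps)
      then show ?thesis
        using exists_least_iff[of "\<lambda>m. norm (x - y) \<le> 2 ^ m * \<delta>"] that by blast
    qed
    have "m \<noteq> 0"
      using True m(1) by (intro notI) simp
    then obtain k where k: "m = Suc k"
      by (cases m) auto
    have "2 ^ k * \<delta> \<le> norm (x - y)"
      using m(2)[of k] k by simp
    then have "(2 ^ k * \<delta>) powr (real n + s) \<le> norm (x - y) powr (real n + s)"
      using \<delta> \<open>0 < s\<close> by (intro powr_mono2) auto
    then have "tail_kernel s \<delta> x y \<le> c k"
      using True \<delta> by (auto simp: tail_kernel_def c_def n_def intro!: divide_left_mono mult_pos_pos)
    then have "ennreal (tail_kernel s \<delta> x y)
        \<le> ennreal (c k) * indicator (cball x (2 ^ Suc k * \<delta>)) y"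
      using m(1) k by (simp add: ennreal_leI dist_norm)
    also have "\<dots> = (\<Sum>k\<in>{k}. ennreal (c k) * indicator (cball x (2 ^ Suc k * \<delta>)) y)"
      by (simp only: sum.insert finite.emptyI sum.empty empty_iff not_False_eq_True add_0_right)
    also have "\<dots> \<le> (\<Sum>k. ennreal (c k) * indicator (cball x (2 ^ Suc k * \<delta>)) y)"
      by (intro sum_le_suminf) auto
    finally show ?thesis .
  qed (simp add: tail_kernel_def)
  \<comment> \<open>The \<open>n\<close>-th power of the radius in the ball volume cancels against
    the kernel up to \<open>2 ^ n\<close>, leaving only the decay
    \<open>(2 ^ k * \<delta>) powr - s\<close>.\<close>
  have summand: "c k * (V * (2 ^ Suc k * \<delta>) ^ n) = V * 2 ^ n * \<delta> powr - s * q ^ k" for k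
  proof -
    have "(2 ^ k * \<delta>) powr (real n + s) = (2 ^ k * \<delta>) ^ n * ((2 ^ k) powr s * \<delta> powr s)"
      using \<delta> by (simp add: powr_add powr_realpow powr_mult power_mult_distrib)
    moreover have "q ^ k = 1 / (2 ^ k) powr s"
    proof -
      have "(2 ^ k :: real) powr s = (2 powr real k) powr s"
        by (simp add: powr_realpow)
      also have "\<dots> = (2 powr s) powr real k"
        by (simp add: powr_powr mult.commute)
      also have "\<dots> = (2 powr s) ^ k"
        by (simp add: powr_realpow)
      finally show ?thesis
        by (simp add: q_def powr_minus_divide power_one_over)
    qed
    ultimately show ?thesis
      using \<delta> by (simp add: c_def powr_minus_divide field_simps)
  qed
  have "(\<integral>\<^sup>+y. ennreal (tail_kernel s \<delta> x y) \<partial>lebesgue)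
      \<le> (\<integral>\<^sup>+y. (\<Sum>k. ennreal (c k) * indicator (cball x (2 ^ Suc k * \<delta>)) y) \<partial>lebesgue)"
    by (intro nn_integral_mono layer)
  also have "\<dots> = (\<Sum>k. ennreal (c k) * emeasure lebesgue (cball x (2 ^ Suc k * \<delta>)))"
    by (subst nn_integral_suminf) (auto simp: nn_integral_cmult_indicator
        intro!: borel_measurable_times_ennreal borel_measurable_indicator)
  also have "\<dots> = (\<Sum>k. ennreal (V * 2 ^ n * \<delta> powr - s * q ^ k))"
  proof (rule arg_cong[where f = suminf], rule ext)
    fix k
    have "emeasure lebesgue (cball x (2 ^ Suc k * \<delta>)) = ennreal (V * (2 ^ Suc k * \<delta>) ^ n)"
      using \<delta> by (simp add: emeasure_cball V_def n_def)
    then show "ennreal (c k) * emeasure lebesgue (cball x (2 ^ Suc k * \<delta>))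
        = ennreal (V * 2 ^ n * \<delta> powr - s * q ^ k)"
      using c_nonneg[of k] V \<delta> by (simp only: summand flip: ennreal_mult')
  qed
  also have "\<dots> = ennreal (\<Sum>k. V * 2 ^ n * \<delta> powr - s * q ^ k)"
    using q V by (intro suminf_ennreal2 summable_mult summable_geometric) auto
  also have "(\<Sum>k. V * 2 ^ n * \<delta> powr - s * q ^ k) = A * \<delta> powr - s"
    using q by (subst suminf_mult) (auto simp: suminf_geometric summable_geometric A_def)
  finally show "(\<integral>\<^sup>+y. ennreal (tail_kernel s \<delta> x y) \<partial>lebesgue) \<le> ennreal (A * \<delta> powr - s)" .
qed

section \<open>Principal values: effect of truncation, and a countable criterion for
  existence\<close>

text \<open>The second case relies on \<^const>\<open>Lim\<close> returning the same unspecified value for all divergent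
  functions.\<close>

lemma pv_integral_truncation_diff:
  fixes f :: "real ^ 'n \<Rightarrow> 'b::euclidean_space"
  assumes "0 < \<delta>" and int: "\<And>\<epsilon>. 0 < \<epsilon> \<Longrightarrow> set_integrable lebesgue {y. \<epsilon> < norm (x - y)} f"
  defines "G \<equiv> \<lambda>\<epsilon>. LINT y:{y. \<epsilon> < norm (x - y)}|lebesgue. f y"
  shows "pv_integral x (\<lambda>y. indicator {y. norm (x - y) \<le> \<delta>} y *\<^sub>R f y) - pv_integral x f =
    (if \<exists>l. (G \<longlongrightarrow> l) (at_right 0) then - G \<delta> else 0)"
proof -
  define H where
    "H = (\<lambda>\<epsilon>. LINT y:{y. \<epsilon> < norm (x - y)}|lebesgue. indicator {y. norm (x - y) \<le> \<delta>} y *\<^sub>R f y)"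
  have pv: "pv_integral x (\<lambda>y. indicator {y. norm (x - y) \<le> \<delta>} y *\<^sub>R f y) = Lim (at_right 0) H"
    "pv_integral x f = Lim (at_right 0) G"
    by (simp_all add: pv_integral_def H_def G_def)
  \<comment> \<open>Below \<open>\<delta>\<close> the truncated integral runs over an annulus, which
    is the difference of two exteriors of balls. So near 0 the functions \<open>H\<close> and
    \<open>G\<close> differ by a constant and converge or diverge together.\<close>
  have H: "H \<epsilon> = G \<epsilon> - G \<delta>" if "\<epsilon> \<in> {0<..<\<delta>}" for \<epsilon>
  proof -
    have "G \<epsilon> - G \<delta> = (\<integral>y. indicator {y. \<epsilon> < norm (x - y)} y *\<^sub>R f y
        - indicator {y. \<delta> < norm (x - y)} y *\<^sub>R f y \<partial>lebesgue)"
      using int[of \<epsilon>] int[of \<delta>] that \<open>0 < \<delta>\<close>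
      unfolding G_def set_lebesgue_integral_def set_integrable_def
      by (intro Bochner_Integration.integral_diff[symmetric]) auto
    also have "\<dots> = H \<epsilon>"
      using that unfolding H_def set_lebesgue_integral_def
      by (intro Bochner_Integration.integral_cong) (auto simp: indicator_def)
    finally show ?thesis ..
  qed
  have ev: "eventually (\<lambda>\<epsilon>. H \<epsilon> = G \<epsilon> - G \<delta>) (at_right 0)"
    unfolding eventually_at_right_field using H \<open>0 < \<delta>\<close> by (intro exI[of _ \<delta>]) auto
  have lim: "(H \<longlongrightarrow> l - G \<delta>) (at_right 0) \<longleftrightarrow> (G \<longlongrightarrow> l) (at_right 0)" for l
  proof -
    have "(H \<longlongrightarrow> l - G \<delta>) (at_right 0) \<longleftrightarrow> ((\<lambda>\<epsilon>. G \<epsilon> - G \<delta>) \<longlongrightarrow> l - G \<delta>) (at_right 0)"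
      by (rule tendsto_cong[OF ev])
    also have "\<dots> \<longleftrightarrow> (G \<longlongrightarrow> l) (at_right 0)"
      using tendsto_add_const_iff[of "- G \<delta>" G l] by (simp add: add.commute)
    finally show ?thesis .
  qed
  show ?thesis
  proof (cases "\<exists>l. (G \<longlongrightarrow> l) (at_right 0)")
    case True
    then obtain l where l: "(G \<longlongrightarrow> l) (at_right 0)" ..
    then have "Lim (at_right 0) G = l" "Lim (at_right 0) H = l - G \<delta>"
      using lim by (auto intro!: tendsto_Lim)
    with True show ?thesis
      by (simp add: pv)
  next
    case False
    have "\<not> (H \<longlongrightarrow> l) (at_right 0)" for l
      using lim[of "l + G \<delta>"] False by auto
    then have "Lim (at_right 0) H = Lim (at_right 0) G"
      using False by (simp add: t2_space_class.Lim_def)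
    with False show ?thesis
      by (simp add: pv)
  qed
qed

text \<open>Because the inequality is strict, the indicators converge at every point when the radii
  approach \<open>\<epsilon>\<close> from above, and the integrand outside the smaller ball
  dominates. This right-continuity is what lets rational radii control all radii.\<close>

lemma set_integral_outside_right_sequence:
  fixes f :: "real ^ 'n \<Rightarrow> 'b::euclidean_space"
  assumes "0 < \<epsilon>" and int: "set_integrable lebesgue {y. \<epsilon> < norm (x - y)} f"
    and "\<And>n. \<epsilon> < q n" and "q \<longlonglongrightarrow> \<epsilon>"
  shows "(\<lambda>n. LINT y:{y. q n < norm (x - y)}|lebesgue. f y)
    \<longlonglongrightarrow> (LINT y:{y. \<epsilon> < norm (x - y)}|lebesgue. f y)"
  unfolding set_lebesgue_integral_def
proof (rule integral_dominated_convergence)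
  have int': "integrable lebesgue (\<lambda>y. indicator {y. \<epsilon> < norm (x - y)} y *\<^sub>R f y)"
    using int by (simp add: set_integrable_def)
  show "integrable lebesgue (\<lambda>y. norm (indicator {y. \<epsilon> < norm (x - y)} y *\<^sub>R f y))"
    using int' by (rule integrable_norm)
  show [measurable]: "(\<lambda>y. indicator {y. \<epsilon> < norm (x - y)} y *\<^sub>R f y) \<in> borel_measurable lebesgue"
    using int' by (rule borel_measurable_integrable)
  show "(\<lambda>y. indicator {y. q n < norm (x - y)} y *\<^sub>R f y) \<in> borel_measurable lebesgue" for n
  proof -
    \<comment> \<open>Only the restriction of \<open>f\<close> to the larger exterior is known to be
      measurable, so the smaller indicator is multiplied onto that restriction.\<close>
    have "(\<lambda>y. indicator {y. q n < norm (x - y)} y *\<^sub>R (indicator {y. \<epsilon> < norm (x - y)} y *\<^sub>R f y))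
        \<in> borel_measurable lebesgue"
      by measurable
    also have "(\<lambda>y. indicator {y. q n < norm (x - y)} y *\<^sub>R (indicator {y. \<epsilon> < norm (x - y)} y *\<^sub>R f y))
        = (\<lambda>y. indicator {y. q n < norm (x - y)} y *\<^sub>R f y)"
      using assms(3)[of n] by (auto simp: indicator_def fun_eq_iff)
    finally show ?thesis .
  qed
  show "AE y in lebesgue. (\<lambda>n. indicator {y. q n < norm (x - y)} y *\<^sub>R f y)
      \<longlonglongrightarrow> indicator {y. \<epsilon> < norm (x - y)} y *\<^sub>R f y"
  proof (rule AE_I2)
    fix y
    show "(\<lambda>n. indicator {y. q n < norm (x - y)} y *\<^sub>R f y)
      \<longlonglongrightarrow> indicator {y. \<epsilon> < norm (x - y)} y *\<^sub>R f y"
    proof (cases "\<epsilon> < norm (x - y)")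
      case True
      then have "eventually (\<lambda>n. q n < norm (x - y)) sequentially"
        using \<open>q \<longlonglongrightarrow> \<epsilon>\<close> order_tendstoD(2) by blast
      then have "eventually (\<lambda>n. indicator {y. q n < norm (x - y)} y *\<^sub>R f y
          = indicator {y. \<epsilon> < norm (x - y)} y *\<^sub>R f y) sequentially"
        by eventually_elim (use True in simp)
      then show ?thesis
        by (rule tendsto_eventually)
    next
      case False
      have "\<not> q n < norm (x - y)" for n
        using False assms(3)[of n] by linarith
      with False show ?thesis
        by simp
    qed
  qed
  show "AE y in lebesgue. norm (indicator {y. q n < norm (x - y)} y *\<^sub>R f y)
      \<le> norm (indicator {y. \<epsilon> < norm (x - y)} y *\<^sub>R f y)" for n
    using assms(3)[of n] by (intro AE_I2) (auto simp: indicator_def)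
qed

text \<open>Reduces convergence to countably many conditions, so that the set of points where a principal
  value exists is measurable.\<close>

lemma convergent_at_right_0_iff_rational:
  fixes G :: "real \<Rightarrow> 'b::euclidean_space"
  assumes right: "\<And>\<epsilon> q. 0 < \<epsilon> \<Longrightarrow> (\<And>n. \<epsilon> < q n) \<Longrightarrow> q \<longlonglongrightarrow> \<epsilon> \<Longrightarrow> (\<lambda>n. G (q n)) \<longlonglongrightarrow> G \<epsilon>"
  shows "(\<exists>l. (G \<longlongrightarrow> l) (at_right 0)) \<longleftrightarrow>
    (\<forall>k::nat. \<exists>m::nat. \<forall>a\<in>\<rat>. \<forall>b\<in>\<rat>. 0 < a \<and> a < 1 / Suc m \<and> 0 < b \<and> b < 1 / Suc m \<longrightarrow>
       norm (G a - G b) \<le> 1 / Suc k)"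
    (is "?L \<longleftrightarrow> ?R")
proof
  assume ?L
  then obtain l where l: "(G \<longlongrightarrow> l) (at_right 0)" ..
  show ?R
  proof
    fix k :: nat
    have "eventually (\<lambda>\<epsilon>. dist (G \<epsilon>) l < 1 / (2 * Suc k)) (at_right 0)"
      using l by (intro tendstoD) auto
    then obtain d where d: "0 < d" "\<And>\<epsilon>. 0 < \<epsilon> \<Longrightarrow> \<epsilon> < d \<Longrightarrow> dist (G \<epsilon>) l < 1 / (2 * Suc k)"
      by (auto simp: eventually_at_right_field)
    obtain m where m: "1 / Suc m < d"
      using \<open>0 < d\<close> nat_approx_posE by blast
    have "norm (G a - G b) \<le> 1 / Suc k" if "0 < a" "a < 1 / Suc m" "0 < b" "b < 1 / Suc m" for a b
    proof -
      have "dist (G a) (G b) < 1 / (2 * Suc k) + 1 / (2 * Suc k)"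
        using d(2)[of a] d(2)[of b] that m
        by (intro dist_triangle_less_add[of _ l]) auto
      then show ?thesis
        by (simp add: dist_norm field_simps)
    qed
    then show "\<exists>m::nat. \<forall>a\<in>\<rat>. \<forall>b\<in>\<rat>. 0 < a \<and> a < 1 / Suc m \<and> 0 < b \<and> b < 1 / Suc m \<longrightarrow>
       norm (G a - G b) \<le> 1 / Suc k"
      by blast
  qed
next
  assume R: ?R
  \<comment> \<open>The bound \<open>r\<close> will be \<open>1 / Suc m\<close>: the rational
    approximants must stay in the window where the assumption applies.\<close>
  have approx: "\<exists>q. (\<forall>n. q n \<in> \<rat> \<and> \<epsilon> < q n \<and> q n < r) \<and> q \<longlonglongrightarrow> \<epsilon>" if "\<epsilon> < r" for \<epsilon> r :: real
  proof -
    have "\<exists>q. q \<in> \<rat> \<and> \<epsilon> < q \<and> q < min r (\<epsilon> + 1 / Suc n)" for n :: nat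
      using Rats_dense_in_real[of \<epsilon> "min r (\<epsilon> + 1 / Suc n)"] that by auto
    then obtain q where q: "\<And>n. q n \<in> \<rat>" "\<And>n. \<epsilon> < q n" "\<And>n. q n < min r (\<epsilon> + 1 / Suc n)"
      by metis
    have "(\<lambda>n. \<epsilon> + 1 / Suc n) \<longlonglongrightarrow> \<epsilon> + 0"
      by (intro tendsto_intros LIMSEQ_Suc[OF lim_1_over_n])
    then have "q \<longlonglongrightarrow> \<epsilon>"
      by (intro tendsto_sandwich[of "\<lambda>_. \<epsilon>" q _ "\<lambda>n. \<epsilon> + 1 / Suc n"])
        (use q in \<open>auto intro!: always_eventually less_imp_le\<close>)
    with q show ?thesis
      by (intro exI[of _ q]) auto
  qed
  \<comment> \<open>The estimate passes from rational to real radii by right-continuity; being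
    non-strict, it survives the limit.\<close>
  have all: "\<exists>m::nat. \<forall>a b. 0 < a \<and> a < 1 / Suc m \<and> 0 < b \<and> b < 1 / Suc m \<longrightarrow>
       norm (G a - G b) \<le> 1 / Suc k" for k :: nat
  proof -
    obtain m :: nat where m: "\<And>a b. a \<in> \<rat> \<Longrightarrow> b \<in> \<rat> \<Longrightarrow> 0 < a \<Longrightarrow> a < 1 / Suc m \<Longrightarrow> 0 < b \<Longrightarrow>
        b < 1 / Suc m \<Longrightarrow> norm (G a - G b) \<le> 1 / Suc k"
      using R by meson
    have "norm (G a - G b) \<le> 1 / Suc k" if ab: "0 < a" "a < 1 / Suc m" "0 < b" "b < 1 / Suc m" for a b
    proof -
      obtain p where p: "\<And>n. p n \<in> \<rat>" "\<And>n. a < p n" "\<And>n. p n < 1 / Suc m" "p \<longlonglongrightarrow> a"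
        using approx[OF ab(2)] by blast
      obtain q where q: "\<And>n. q n \<in> \<rat>" "\<And>n. b < q n" "\<And>n. q n < 1 / Suc m" "q \<longlonglongrightarrow> b"
        using approx[OF ab(4)] by blast
      have "(\<lambda>n. norm (G (p n) - G (q n))) \<longlonglongrightarrow> norm (G a - G b)"
        using right[OF ab(1) p(2) p(4)] right[OF ab(3) q(2) q(4)] by (intro tendsto_intros)
      moreover have "norm (G (p n) - G (q n)) \<le> 1 / Suc k" for n
        using p(2)[of n] q(2)[of n] ab by (intro m p q) auto
      ultimately show ?thesis
        using LIMSEQ_le_const2 by blast
    qed
    then show ?thesis
      by blast
  qed
  \<comment> \<open>The limit is not known in advance, so it is obtained from completeness of the
    range space once the image filter is shown to be Cauchy.\<close>
  have "cauchy_filter (filtermap G (at_right 0))"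
    unfolding cauchy_filter_metric_filtermap
  proof (intro allI impI)
    fix e :: real assume "0 < e"
    then obtain k where k: "1 / Suc k < e"
      using nat_approx_posE by blast
    obtain m :: nat where "\<forall>a b. 0 < a \<and> a < 1 / Suc m \<and> 0 < b \<and> b < 1 / Suc m \<longrightarrow>
       norm (G a - G b) \<le> 1 / Suc k"
      using all[of k] by blast
    moreover have "eventually (\<lambda>\<epsilon>. 0 < \<epsilon> \<and> \<epsilon> < 1 / Suc m) (at_right (0::real))"
      unfolding eventually_at_right_field by (intro exI[of _ "1 / Suc m"]) auto
    ultimately show "\<exists>P. eventually P (at_right 0) \<and> (\<forall>x y. P x \<and> P y \<longrightarrow> dist (G x) (G y) < e)"
      using k by (intro exI[of _ "\<lambda>\<epsilon>. 0 < \<epsilon> \<and> \<epsilon> < 1 / Suc m"]) (fastforce simp: dist_norm)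
  qed
  then obtain l where "filtermap G (at_right 0) \<le> nhds l"
    using cauchy_filter_complete_converges[of "filtermap G (at_right 0)" UNIV]
    by (auto simp: complete_UNIV filtermap_bot_iff)
  then show ?L
    by (auto simp: filterlim_def)
qed

section \<open>The tail estimate in a form common to gradient and divergence\<close>

text \<open>Here \<open>w\<close> stands for \<open>u\<close> or \<open>v\<close> and
  \<open>F\<close> for the corresponding integrand, so one estimate on the size of \<open>F\<close>
  serves both operators.\<close>

locale tail_dominated_kernel =
  fixes s :: real and w :: "real ^ 'n \<Rightarrow> 'b::euclidean_space"
    and F :: "real ^ 'n \<Rightarrow> real ^ 'n \<Rightarrow> 'c::euclidean_space"
  assumes s_pos: "0 < s"
    and w_integrable: "integrable lebesgue w"
    and w_square_integrable: "integrable lebesgue (\<lambda>x. (norm (w x))\<^sup>2)"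
    and F_measurable: "case_prod F \<in> borel_measurable (lebesgue \<Otimes>\<^sub>M lebesgue)"
    and F_bound: "norm (F x y) \<le> norm (w x - w y) / norm (x - y) powr (real CARD('n) + s)"
begin

lemma w_measurable [measurable]: "w \<in> borel_measurable lebesgue"
  using w_integrable by (rule borel_measurable_integrable)

lemma F_measurable' [measurable (raw)]:
  "f \<in> M \<rightarrow>\<^sub>M lebesgue \<Longrightarrow> g \<in> M \<rightarrow>\<^sub>M lebesgue \<Longrightarrow> (\<lambda>z. F (f z) (g z)) \<in> borel_measurable M"
  using measurable_compose[OF measurable_Pair F_measurable, of f M g] by simp

definition outer :: "real \<Rightarrow> real ^ 'n \<Rightarrow> 'c" where
  "outer \<epsilon> x = (LINT y:{y. \<epsilon> < norm (x - y)}|lebesgue. F x y)"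

definition pv_exists :: "real ^ 'n \<Rightarrow> bool" where
  "pv_exists x \<longleftrightarrow> (\<exists>l. ((\<lambda>\<epsilon>. outer \<epsilon> x) \<longlongrightarrow> l) (at_right 0))"

definition trunc_error :: "real \<Rightarrow> real ^ 'n \<Rightarrow> 'c" where
  "trunc_error \<delta> x =
     pv_integral x (\<lambda>y. indicator {y. norm (x - y) \<le> \<delta>} y *\<^sub>R F x y) - pv_integral x (F x)"

lemma norm_outer_integrand_le:
  "norm (indicator {y. \<epsilon> < norm (x - y)} y *\<^sub>R F x y) \<le> tail_kernel s \<epsilon> x y * norm (w x - w y)"
  using F_bound[of x y] by (simp add: tail_kernel_def indicator_def)

text \<open>After the triangle inequality, \<open>w x\<close> is constant in \<open>y\<close> and
  multiplies an integrable kernel, while \<open>w y\<close> is integrable and multiplies a kernel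
  bounded by its value at radius \<open>\<epsilon>\<close>. Integrability of \<open>w\<close> enters
  here.\<close>

lemma set_integrable_outer:
  assumes "0 < \<epsilon>"
  shows "set_integrable lebesgue {y. \<epsilon> < norm (x - y)} (F x)"
proof -
  obtain A where A: "0 \<le> A" "\<And>\<delta> x. 0 < \<delta> \<Longrightarrow>
      (\<integral>\<^sup>+y. ennreal (tail_kernel s \<delta> (x::real^'n) y) \<partial>lebesgue) \<le> ennreal (A * \<delta> powr - s)"
    using tail_kernel_integral_le[OF s_pos, where 'a="real^'n"] by metis
  have k: "integrable lebesgue (tail_kernel s \<epsilon> x)"
  proof (rule integrableI_nonneg)
    show "(\<integral>\<^sup>+y. ennreal (tail_kernel s \<epsilon> x y) \<partial>lebesgue) < \<infinity>"
      using A(2)[OF assms, of x] by (rule le_less_trans) simp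
  qed (auto simp: tail_kernel_nonneg)
  define g where
    "g y = tail_kernel s \<epsilon> x y * norm (w x) + norm (w y) / \<epsilon> powr (real CARD('n) + s)" for y
  have "integrable lebesgue g"
    using k w_integrable unfolding g_def
    by (intro Bochner_Integration.integrable_add integrable_mult_left integrable_divide
        integrable_norm) auto
  moreover have "(\<lambda>y. indicator {y. \<epsilon> < norm (x - y)} y *\<^sub>R F x y) \<in> borel_measurable lebesgue"
    by measurable
  moreover have "norm (indicator {y. \<epsilon> < norm (x - y)} y *\<^sub>R F x y) \<le> norm (g y)" for y
  proof -
    have "tail_kernel s \<epsilon> x y \<le> 1 / \<epsilon> powr (real CARD('n) + s)"
      using assms s_pos by (auto simp: tail_kernel_def intro!: divide_left_mono powr_mono2 mult_pos_pos)
    then have "tail_kernel s \<epsilon> x y * norm (w y) \<le> 1 / \<epsilon> powr (real CARD('n) + s) * norm (w y)"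
      by (rule mult_right_mono) simp
    moreover have "tail_kernel s \<epsilon> x y * norm (w x - w y)
        \<le> tail_kernel s \<epsilon> x y * (norm (w x) + norm (w y))"
      by (intro mult_left_mono norm_triangle_ineq4 tail_kernel_nonneg)
    ultimately have "tail_kernel s \<epsilon> x y * norm (w x - w y) \<le> g y"
      by (simp add: g_def distrib_left)
    then show ?thesis
      using norm_outer_integrand_le[of \<epsilon> x y] by simp
  qed
  ultimately show ?thesis
    unfolding set_integrable_def by (rule Bochner_Integration.integrable_bound[OF _ _ AE_I2])
qed

lemma outer_measurable [measurable]: "outer \<epsilon> \<in> borel_measurable lebesgue"
  unfolding outer_def set_lebesgue_integral_def
  by (rule lebesgue.borel_measurable_lebesgue_integral) (simp add: case_prod_beta')

text \<open>The truncation error is given by cases on \<open>pv_exists\<close>, so its measurability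
  rests on this. The rational criterion leaves only countable quantifiers over measurable
  conditions.\<close>

lemma pv_exists_measurable [measurable]: "Measurable.pred lebesgue pv_exists"
proof -
  have "pv_exists = (\<lambda>x.
    \<forall>k::nat. \<exists>m::nat. \<forall>a\<in>\<rat>. \<forall>b\<in>\<rat>. 0 < a \<and> a < 1 / Suc m \<and> 0 < b \<and> b < 1 / Suc m \<longrightarrow>
       norm (outer a x - outer b x) \<le> 1 / Suc k)"
    by (rule ext, unfold pv_exists_def, rule convergent_at_right_0_iff_rational, unfold outer_def)
      (intro set_integral_outside_right_sequence set_integrable_outer)
  moreover have "Measurable.pred lebesgue (\<lambda>x.
    \<forall>k::nat. \<exists>m::nat. \<forall>a\<in>\<rat>. \<forall>b\<in>\<rat>. 0 < a \<and> a < 1 / Suc m \<and> 0 < b \<and> b < 1 / Suc m \<longrightarrow>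
       norm (outer a x - outer b x) \<le> 1 / Suc k)"
    unfolding pred_def
    by (intro sets.sets_Collect_countable_All sets.sets_Collect_countable_Ex
        sets.sets_Collect_countable_All' countable_rat) measurable
  ultimately show ?thesis
    by (simp only:)
qed

lemma trunc_error_eq:
  assumes "0 < \<delta>"
  shows "trunc_error \<delta> x = (if pv_exists x then - outer \<delta> x else 0)"
  unfolding trunc_error_def pv_exists_def outer_def
  by (rule pv_integral_truncation_diff[OF assms set_integrable_outer])

lemma trunc_error_measurable: "0 < \<delta> \<Longrightarrow> trunc_error \<delta> \<in> borel_measurable lebesgue"
  by (subst measurable_cong[OF trunc_error_eq]) auto

lemma norm_trunc_error_le: "0 < \<delta> \<Longrightarrow> norm (trunc_error \<delta> x) \<le> norm (outer \<delta> x)"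
  by (simp add: trunc_error_eq)

text \<open>Cauchy-Schwarz after writing the kernel as a product of two square roots: one factor
  keeps the mass of the kernel, the other the weighted square of the difference.\<close>

lemma norm_outer_square_le:
  assumes "0 < \<delta>"
  shows "ennreal ((norm (outer \<delta> x))\<^sup>2)
    \<le> (\<integral>\<^sup>+y. ennreal (tail_kernel s \<delta> x y) \<partial>lebesgue)
      * (\<integral>\<^sup>+y. ennreal (tail_kernel s \<delta> x y * (norm (w x - w y))\<^sup>2) \<partial>lebesgue)"
proof -
  let ?k = "\<lambda>y. tail_kernel s \<delta> x y"
  have "ennreal (norm (outer \<delta> x))
      \<le> (\<integral>\<^sup>+y. ennreal (norm (indicator {y. \<delta> < norm (x - y)} y *\<^sub>R F x y)) \<partial>lebesgue)"
    using set_integrable_outer[OF assms, of x]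
    unfolding outer_def set_lebesgue_integral_def set_integrable_def
    by (rule integral_norm_bound_ennreal)
  also have "\<dots> \<le> (\<integral>\<^sup>+y. ennreal (sqrt (?k y)) * ennreal (sqrt (?k y) * norm (w x - w y)) \<partial>lebesgue)"
    using norm_outer_integrand_le[of \<delta> x]
    by (intro nn_integral_mono)
      (simp add: tail_kernel_nonneg ennreal_leI flip: ennreal_mult' mult.assoc real_sqrt_mult)
  finally have "(ennreal (norm (outer \<delta> x)))\<^sup>2
      \<le> (\<integral>\<^sup>+y. ennreal (sqrt (?k y)) * ennreal (sqrt (?k y) * norm (w x - w y)) \<partial>lebesgue)\<^sup>2"
    by (rule power_mono) simp
  also have "\<dots> \<le> (\<integral>\<^sup>+y. (ennreal (sqrt (?k y)))\<^sup>2 \<partial>lebesgue)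
      * (\<integral>\<^sup>+y. (ennreal (sqrt (?k y) * norm (w x - w y)))\<^sup>2 \<partial>lebesgue)"
    by (rule Cauchy_Schwarz_nn_integral) measurable
  finally show ?thesis
    by (simp add: tail_kernel_nonneg ennreal_power power_mult_distrib)
qed

text \<open>The mass bound is used twice, once for the first Cauchy-Schwarz factor and once when the
  kernel is integrated against the square of \<open>norm (w x)\<close>; hence the square of
  \<open>\<delta> powr - s\<close>. The mass constant does not depend on \<open>\<delta>\<close>, so
  neither does \<open>C\<close>.\<close>

lemma nn_integral_outer_square_le:
  "\<exists>C\<ge>0. \<forall>\<delta>>0.
    (\<integral>\<^sup>+x. ennreal ((norm (outer \<delta> x))\<^sup>2) \<partial>lebesgue) \<le> ennreal ((C * \<delta> powr - s)\<^sup>2)"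
proof -
  obtain A where A: "0 \<le> A" "\<And>\<delta> x. 0 < \<delta> \<Longrightarrow>
      (\<integral>\<^sup>+y. ennreal (tail_kernel s \<delta> (x::real^'n) y) \<partial>lebesgue) \<le> ennreal (A * \<delta> powr - s)"
    using tail_kernel_integral_le[OF s_pos, where 'a="real^'n"] by metis
  define W where "W = (\<integral>x. (norm (w x))\<^sup>2 \<partial>lebesgue)"
  have W: "(\<integral>\<^sup>+x. ennreal ((norm (w x))\<^sup>2) \<partial>lebesgue) = ennreal W" "0 \<le> W"
    using w_square_integrable by (auto simp: W_def nn_integral_eq_integral)
  have "(\<integral>\<^sup>+x. ennreal ((norm (outer \<delta> x))\<^sup>2) \<partial>lebesgue) \<le> ennreal ((2 * A * sqrt W * \<delta> powr - s)\<^sup>2)"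
    if "0 < \<delta>" for \<delta>
  proof -
    let ?k = "tail_kernel s \<delta>"
    define a where "a = A * \<delta> powr - s"
    have a: "0 \<le> a" "\<And>x::real^'n. (\<integral>\<^sup>+y. ennreal (?k x y) \<partial>lebesgue) \<le> ennreal a"
      using A that by (auto simp: a_def)
    have half: "(\<integral>\<^sup>+x. (\<integral>\<^sup>+y. ennreal (?k x y * (norm (w x))\<^sup>2) \<partial>lebesgue) \<partial>lebesgue)
        \<le> ennreal (a * W)"
    proof -
      have "(\<integral>\<^sup>+x. (\<integral>\<^sup>+y. ennreal (?k x y * (norm (w x))\<^sup>2) \<partial>lebesgue) \<partial>lebesgue)
          = (\<integral>\<^sup>+x. (\<integral>\<^sup>+y. ennreal (?k x y) \<partial>lebesgue) * ennreal ((norm (w x))\<^sup>2) \<partial>lebesgue)"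
        by (simp add: ennreal_mult'' nn_integral_multc)
      also have "\<dots> \<le> (\<integral>\<^sup>+x. ennreal a * ennreal ((norm (w x))\<^sup>2) \<partial>lebesgue)"
        by (intro nn_integral_mono mult_right_mono a) simp
      also have "\<dots> = ennreal (a * W)"
        using a W by (simp add: nn_integral_cmult ennreal_mult)
      finally show ?thesis .
    qed
    \<comment> \<open>Tonelli together with the symmetry of the kernel reduces the term in
      \<open>w y\<close> to the term in \<open>w x\<close>.\<close>
    have swap: "(\<integral>\<^sup>+x. (\<integral>\<^sup>+y. ennreal (?k x y * (norm (w y))\<^sup>2) \<partial>lebesgue) \<partial>lebesgue)
        = (\<integral>\<^sup>+x. (\<integral>\<^sup>+y. ennreal (?k x y * (norm (w x))\<^sup>2) \<partial>lebesgue) \<partial>lebesgue)"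
      by (subst lebesgue_pair.Fubini') (simp_all add: case_prod_beta' tail_kernel_commute[of s \<delta>])
    have "(\<integral>\<^sup>+x. ennreal ((norm (outer \<delta> x))\<^sup>2) \<partial>lebesgue)
        \<le> (\<integral>\<^sup>+x. ennreal a * (\<integral>\<^sup>+y. ennreal (?k x y * (norm (w x - w y))\<^sup>2) \<partial>lebesgue) \<partial>lebesgue)"
      by (intro nn_integral_mono order_trans[OF norm_outer_square_le[OF that]] mult_right_mono a) simp
    also have "\<dots> = ennreal a * (\<integral>\<^sup>+x. (\<integral>\<^sup>+y. ennreal (?k x y * (norm (w x - w y))\<^sup>2) \<partial>lebesgue) \<partial>lebesgue)"
      by (rule nn_integral_cmult) measurable
    also have "\<dots> \<le> ennreal a * (\<integral>\<^sup>+x. (\<integral>\<^sup>+y. 2 * ennreal (?k x y * (norm (w x))\<^sup>2)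
        + 2 * ennreal (?k x y * (norm (w y))\<^sup>2) \<partial>lebesgue) \<partial>lebesgue)"
    proof (intro mult_left_mono nn_integral_mono)
      fix x y
      have "(norm (w x - w y))\<^sup>2 \<le> (norm (w x) + norm (w y))\<^sup>2"
        by (intro power_mono norm_triangle_ineq4) simp
      also have "\<dots> \<le> 2 * (norm (w x))\<^sup>2 + 2 * (norm (w y))\<^sup>2"
        using sum_squares_bound[of "norm (w x)" "norm (w y)"] by (simp add: power2_sum)
      finally have "?k x y * (norm (w x - w y))\<^sup>2
          \<le> ?k x y * (2 * (norm (w x))\<^sup>2 + 2 * (norm (w y))\<^sup>2)"
        by (intro mult_left_mono tail_kernel_nonneg)
      then have "ennreal (?k x y * (norm (w x - w y))\<^sup>2)
          \<le> ennreal (2 * (?k x y * (norm (w x))\<^sup>2) + 2 * (?k x y * (norm (w y))\<^sup>2))"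
        by (intro ennreal_leI) (simp add: algebra_simps)
      then show "ennreal (?k x y * (norm (w x - w y))\<^sup>2)
          \<le> 2 * ennreal (?k x y * (norm (w x))\<^sup>2) + 2 * ennreal (?k x y * (norm (w y))\<^sup>2)"
        by (simp add: tail_kernel_nonneg ennreal_mult)
    qed simp
    also have "\<dots> = ennreal a * (2 * (\<integral>\<^sup>+x. (\<integral>\<^sup>+y. ennreal (?k x y * (norm (w x))\<^sup>2) \<partial>lebesgue) \<partial>lebesgue)
        + 2 * (\<integral>\<^sup>+x. (\<integral>\<^sup>+y. ennreal (?k x y * (norm (w y))\<^sup>2) \<partial>lebesgue) \<partial>lebesgue))"
      by (simp add: nn_integral_add nn_integral_cmult)
    also have "\<dots> \<le> ennreal a * (2 * ennreal (a * W) + 2 * ennreal (a * W))"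
      unfolding swap by (intro mult_left_mono add_mono half) auto
    also have "\<dots> = ennreal (a * (2 * (a * W) + 2 * (a * W)))"
      using a W by (simp only: ennreal_mult ennreal_plus ennreal_numeral mult_nonneg_nonneg
          add_nonneg_nonneg zero_le_numeral)
    \<comment> \<open>Two terms, each carrying a factor 2, give \<open>4 * a\<^sup>2 * W\<close>,
      whose square root is the stated constant times \<open>\<delta> powr - s\<close>.\<close>
    also have "a * (2 * (a * W) + 2 * (a * W)) = (2 * A * sqrt W * \<delta> powr - s)\<^sup>2"
      using W by (simp add: a_def power_mult_distrib power2_eq_square[of "\<delta> powr - s"]
          power2_eq_square[of A])
    finally show ?thesis .
  qed
  then show ?thesis
    using A W by (intro exI[of _ "2 * A * sqrt W"]) simp
qed

text \<open>Membership in \<open>L2_space\<close> accompanies the limit because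
  \<open>L2_norm\<close> takes the value 0 when the square is not integrable; the limit alone could
  then hold for the wrong reason.\<close>

theorem trunc_error_L2:
  shows "\<forall>\<delta>>0. trunc_error \<delta> \<in> L2_space"
    and "((\<lambda>\<delta>. L2_norm (trunc_error \<delta>)) \<longlongrightarrow> 0) at_top"
proof -
  obtain C where C: "0 \<le> C" "\<And>\<delta>. 0 < \<delta> \<Longrightarrow>
      (\<integral>\<^sup>+x. ennreal ((norm (outer \<delta> x))\<^sup>2) \<partial>lebesgue) \<le> ennreal ((C * \<delta> powr - s)\<^sup>2)"
    using nn_integral_outer_square_le by blast
  have le: "(\<integral>\<^sup>+x. ennreal ((norm (trunc_error \<delta> x))\<^sup>2) \<partial>lebesgue) \<le> ennreal ((C * \<delta> powr - s)\<^sup>2)"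
    if "0 < \<delta>" for \<delta>
    by (rule order_trans[OF nn_integral_mono C(2)[OF that]])
      (auto intro!: ennreal_leI power_mono norm_trunc_error_le that)
  \<comment> \<open>Integrability identifies the Bochner integral in \<open>L2_norm\<close> with the
    nonnegative integral bounded in \<open>le\<close>.\<close>
  have int: "integrable lebesgue (\<lambda>x. (norm (trunc_error \<delta> x))\<^sup>2)" if "0 < \<delta>" for \<delta>
  proof (rule integrableI_nonneg)
    show "(\<lambda>x. (norm (trunc_error \<delta> x))\<^sup>2) \<in> borel_measurable lebesgue"
      using trunc_error_measurable[OF that] by measurable
    show "(\<integral>\<^sup>+x. ennreal ((norm (trunc_error \<delta> x))\<^sup>2) \<partial>lebesgue) < \<infinity>"
      using le[OF that] by (rule le_less_trans) simp
  qed simp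
  show "\<forall>\<delta>>0. trunc_error \<delta> \<in> L2_space"
    by (simp add: L2_space_def trunc_error_measurable int)
  have norm_le: "L2_norm (trunc_error \<delta>) \<le> C * \<delta> powr - s" if "0 < \<delta>" for \<delta>
  proof -
    have "(\<integral>x. (norm (trunc_error \<delta> x))\<^sup>2 \<partial>lebesgue) \<le> (C * \<delta> powr - s)\<^sup>2"
      using le[OF that] int[OF that] by (simp add: nn_integral_eq_integral)
    then show ?thesis
      using C(1) unfolding L2_norm_def by (intro real_le_lsqrt) auto
  qed
  have lim: "((\<lambda>\<delta>. C * \<delta> powr - s) \<longlongrightarrow> C * 0) at_top"
    by (intro tendsto_intros tendsto_neg_powr filterlim_ident) (use s_pos in auto)
  show "((\<lambda>\<delta>. L2_norm (trunc_error \<delta>)) \<longlongrightarrow> 0) at_top"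
  proof (rule tendsto_sandwich[of "\<lambda>_. 0"])
    show "\<forall>\<^sub>F \<delta> in at_top. 0 \<le> L2_norm (trunc_error \<delta>)"
      by (simp add: L2_norm_def)
    show "\<forall>\<^sub>F \<delta> in at_top. L2_norm (trunc_error \<delta>) \<le> C * \<delta> powr - s"
      using eventually_gt_at_top[of 0] by eventually_elim (rule norm_le)
  qed (use lim in simp_all)
qed

end

section \<open>Application to the fractional gradient and divergence\<close>

theorem theorem3p4:
  fixes s :: real and u :: "real ^ 'n \<Rightarrow> real" and v :: "real ^ 'n \<Rightarrow> real ^ 'n"
  assumes "0 < s" and "s < 1"
    and "u \<in> Hs_space s" and "integrable lebesgue u"
    and "v \<in> Hs_vec_space s" and "integrable lebesgue (\<lambda>x. norm (v x))"
  shows "(\<forall>\<delta>>0. (\<lambda>x. trunc_div s \<delta> v x - frac_div s v x) \<in> L2_space)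
    \<and> ((\<lambda>\<delta>. L2_norm (\<lambda>x. trunc_div s \<delta> v x - frac_div s v x)) \<longlongrightarrow> 0) at_top
    \<and> (\<forall>\<delta>>0. (\<lambda>x. trunc_grad s \<delta> u x - frac_grad s u x) \<in> L2_space)
    \<and> ((\<lambda>\<delta>. L2_norm (\<lambda>x. trunc_grad s \<delta> u x - frac_grad s u x)) \<longlongrightarrow> 0) at_top"
proof -
  \<comment> \<open>An inequality, since on the diagonal the direction vector is zero by the
    convention for division by zero.\<close>
  have n: "norm ((x - y) /\<^sub>R norm (x - y)) \<le> 1" for x y :: "real ^ 'n"
    by (cases "x = y") auto
  have u: "u \<in> borel_measurable lebesgue" "integrable lebesgue (\<lambda>x. (norm (u x))\<^sup>2)"
    using assms(3) by (auto simp: Hs_space_def L2_space_def)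
  note [measurable] = u(1)
  interpret G: tail_dominated_kernel s u "grad_integrand s u"
  proof
    show "norm (grad_integrand s u x y) \<le> norm (u x - u y) / norm (x - y) powr (real CARD('n) + s)"
      for x y
    proof -
      have "\<bar>u x - u y\<bar> * norm ((x - y) /\<^sub>R norm (x - y)) \<le> \<bar>u x - u y\<bar>"
        using mult_left_mono[OF n, of "\<bar>u x - u y\<bar>" x y] by simp
      then show ?thesis
        unfolding grad_integrand_def norm_scaleR by (simp add: divide_right_mono del: norm_scaleR)
    qed
    show "case_prod (grad_integrand s u) \<in> borel_measurable (lebesgue \<Otimes>\<^sub>M lebesgue)"
      unfolding grad_integrand_def by measurable
  qed (fact assms u)+
  have v_i: "(\<lambda>x. v x $ i) \<in> borel_measurable lebesgue" "integrable lebesgue (\<lambda>x. (v x $ i)\<^sup>2)" for i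
    using assms(5) by (auto simp: Hs_vec_space_def Hs_space_def L2_space_def)
  have v [measurable]: "v \<in> borel_measurable lebesgue"
    by (subst borel_measurable_euclidean_space) (auto simp: Basis_vec_def inner_axis v_i(1))
  \<comment> \<open>Membership in \<open>Hs_vec_space\<close> is componentwise, so square
    integrability of \<open>v\<close> is assembled from that of its components.\<close>
  have "(norm (v x))\<^sup>2 = (\<Sum>i\<in>UNIV. (v x $ i)\<^sup>2)" for x
    by (simp add: norm_vec_def L2_set_def sum_nonneg)
  then have v2: "integrable lebesgue (\<lambda>x. (norm (v x))\<^sup>2)"
    using v_i(2) by simp
  interpret D: tail_dominated_kernel s v "div_integrand s v"
  proof
    show "integrable lebesgue v"
      using assms(6) v by (simp add: integrable_norm_iff)
    show "norm (div_integrand s v x y) \<le> norm (v x - v y) / norm (x - y) powr (real CARD('n) + s)"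
      for x y
    proof -
      have "\<bar>(v x - v y) \<bullet> ((x - y) /\<^sub>R norm (x - y))\<bar>
          \<le> norm (v x - v y) * norm ((x - y) /\<^sub>R norm (x - y))"
        by (rule Cauchy_Schwarz_ineq2)
      also have "\<dots> \<le> norm (v x - v y)"
        using mult_left_mono[OF n, of "norm (v x - v y)" x y] by simp
      finally show ?thesis
        unfolding div_integrand_def by (simp add: divide_right_mono)
    qed
    show "case_prod (div_integrand s v) \<in> borel_measurable (lebesgue \<Otimes>\<^sub>M lebesgue)"
      unfolding div_integrand_def by measurable
  qed (fact assms v2)+
  have "G.trunc_error \<delta> = (\<lambda>x. trunc_grad s \<delta> u x - frac_grad s u x)"
    and "D.trunc_error \<delta> = (\<lambda>x. trunc_div s \<delta> v x - frac_div s v x)" for \<delta>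
    by (intro ext, simp only: G.trunc_error_def D.trunc_error_def trunc_grad_def frac_grad_def
        trunc_div_def frac_div_def)+
  then show ?thesis
    using G.trunc_error_L2 D.trunc_error_L2 by (simp only: simp_thms)
qed

end
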